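(* Assume that the data-fit functional $\ell_n$ depends on $\eta$ only through $\eta(x_1),\eta(x_2),\ldots,\eta(x_n)$. Then there exist $\mathbf{d}=(d_1,\ldots,d_N)'\in\mathbb{R}^N$ and $\mathbf{c}=(c_1,\ldots,c_n)'\in\mathbb{R}^n$ such that $$\hat\beta_{n\lambda}(t)=\sum_{k=1}^N d_k\xi_k(t)+\sum_{i=1}^n c_i\,(Kx_i)(t).$$
   Context: $\mathcal{T}$ is a compact subset of a Euclidean space and $\mathcal{L}_2=\mathcal{L}_2(\mathcal{T})$. The functional linear regression model is $Y=\alpha_0+\int_{\mathcal{T}}X(t)\beta_0(t)\,dt+\varepsilon$, where $X$ is a square integrable random function on $\mathcal{T}$ and $\varepsilon$ is a centered noise variable; $(x_1,y_1),\ldots,(x_n,y_n)$ are $n$ independent copies of $(X,Y)$ (the data). $\mathcal{H}$ is a reproducing kernel Hilbert space that is a subspace of $\mathcal{L}_2$. $J$ is a penalty functional that is a squared semi-norm on $\mathcal{H}$ whose null space $\mathcal{H}_0=\{\beta\in\mathcal{H}: J(\beta)=0\}$ is a finite-dimensional linear subspace of $\mathcal{H}$ with orthonormal basis $\{\xi_1,\ldots,\xi_N\}$, $N=\dim\mathcal{H}_0$. $\mathcal{H}_1$ is the orthogonal complement of $\mathcal{H}_0$ in $\mathcal{H}$; it is a reproducing kernel Hilbert space with the inner product of $\mathcal{H}$ restricted to $\mathcal{H}_1$, and $K(\cdot,\cdot)$ is its reproducing kernel, so that $J(f_1)=\|f_1\|_K^2=\|f_1\|_{\mathcal{H}}^2$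 for $f_1\in\mathcal{H}_1$. $K$ is assumed continuous and square integrable, and also denotes the integral operator $(Kf)(\cdot)=\int_{\mathcal{T}}K(\cdot,s)f(s)\,ds$ on $\mathcal{L}_2$. For a tuning parameter $\lambda\ge0$, the method of regularization defines $$(\hat\alpha_{n\lambda},\hat\beta_{n\lambda})=\mathop{\arg\min}_{\alpha\in\mathbb{R},\,\beta\in\mathcal{H}}\bigl[\ell_n(\eta\mid\mathrm{data})+\lambda J(\beta)\bigr],\qquad \eta(X)=\alpha+\int_{\mathcal{T}}X(t)\beta(t)\,dt,$$ where $\ell_n$ measures how well $\eta$ fits the data (for example the squared error $\ell_n(\eta)=\frac1n\sum_{i=1}^n[y_i-\eta(x_i)]^2$); in general $\ell_n$ is chosen to be convex in $\eta$ and such that $E\ell_n(\eta)$ is uniquely minimized by $\eta_0(X)=\alpha_0+\int_{\mathcal{T}}X(t)\beta_0(t)\,dt$.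
   Formalization: For λ = 0 the slope estimate is assumed to be the unique minimizing β, since the claim fails for an arbitrary minimizer there; for λ > 0 the formal result covers every minimizer. *)

theory Defs
  imports "HOL-Analysis.Analysis"
begin

definition L2_on :: "'a::euclidean_space set \<Rightarrow> ('a \<Rightarrow> real) set" where
  "L2_on T = {f \<in> borel_measurable (lebesgue_on T).
                integrable (lebesgue_on T) (\<lambda>t. (f t)\<^sup>2)}"

text \<open>
  A real function on \<open>T\<close> is represented by its extension by \<open>0\<close> to the whole type, so that
  equality of functions on \<open>T\<close> is HOL equality and the pointwise operations are total.
  The inner product \<open>ip\<close> is only constrained on the carrier \<open>H\<close>.
\<close>

locale hilbert_function_space =
  fixes T :: "'a set"
    and H :: "('a \<Rightarrow> real) set"
    and ip :: "('a \<Rightarrow> real) \<Rightarrow> ('a \<Rightarrow> real) \<Rightarrow> real"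
  assumes support: "f \<in> H \<Longrightarrow> t \<notin> T \<Longrightarrow> f t = 0"
    and zero_mem: "(\<lambda>t. 0) \<in> H"
    and add_mem: "f \<in> H \<Longrightarrow> g \<in> H \<Longrightarrow> (\<lambda>t. f t + g t) \<in> H"
    and scale_mem: "f \<in> H \<Longrightarrow> (\<lambda>t. a * f t) \<in> H"
    and ip_commute: "f \<in> H \<Longrightarrow> g \<in> H \<Longrightarrow> ip f g = ip g f"
    and ip_add_left:
      "f \<in> H \<Longrightarrow> g \<in> H \<Longrightarrow> h \<in> H \<Longrightarrow> ip (\<lambda>t. f t + g t) h = ip f h + ip g h"
    and ip_scale_left: "f \<in> H \<Longrightarrow> g \<in> H \<Longrightarrow> ip (\<lambda>t. a * f t) g = a * ip f g"
    and ip_nonneg: "f \<in> H \<Longrightarrow> 0 \<le> ip f f"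
    and ip_definite: "f \<in> H \<Longrightarrow> ip f f = 0 \<Longrightarrow> f = (\<lambda>t. 0)"
    and complete:
      "(\<And>m. u m \<in> H) \<Longrightarrow>
       (\<And>e. 0 < e \<Longrightarrow> \<exists>M. \<forall>m\<ge>M. \<forall>l\<ge>M.
          sqrt (ip (\<lambda>t. u m t - u l t) (\<lambda>t. u m t - u l t)) < e) \<Longrightarrow>
       \<exists>f\<in>H. (\<lambda>m. sqrt (ip (\<lambda>t. u m t - f t) (\<lambda>t. u m t - f t))) \<longlonglongrightarrow> 0"

locale rkhs = hilbert_function_space +
  assumes eval_bounded: "t \<in> T \<Longrightarrow> \<exists>C. \<forall>f\<in>H. \<bar>f t\<bar> \<le> C * sqrt (ip f f)"

definition reproducing_kernel ::
  "'a set \<Rightarrow> ('a \<Rightarrow> real) set \<Rightarrow> (('a \<Rightarrow> real) \<Rightarrow> ('a \<Rightarrow> real) \<Rightarrow> real)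
    \<Rightarrow> ('a \<Rightarrow> 'a \<Rightarrow> real) \<Rightarrow> bool" where
  "reproducing_kernel T V ip K \<longleftrightarrow>
     (\<forall>t\<in>T. (\<lambda>s. K s t) \<in> V \<and> (\<forall>f\<in>V. f t = ip f (\<lambda>s. K s t)))"

definition seminorm_on :: "('a \<Rightarrow> real) set \<Rightarrow> (('a \<Rightarrow> real) \<Rightarrow> real) \<Rightarrow> bool" where
  "seminorm_on V p \<longleftrightarrow>
     (\<forall>f\<in>V. 0 \<le> p f) \<and>
     (\<forall>a. \<forall>f\<in>V. p (\<lambda>t. a * f t) = \<bar>a\<bar> * p f) \<and>
     (\<forall>f\<in>V. \<forall>g\<in>V. p (\<lambda>t. f t + g t) \<le> p f + p g)"

definition squared_seminorm_on :: "('a \<Rightarrow> real) set \<Rightarrow> (('a \<Rightarrow> real) \<Rightarrow> real) \<Rightarrow> bool" where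
  "squared_seminorm_on V J \<longleftrightarrow> (\<exists>p. seminorm_on V p \<and> (\<forall>f\<in>V. J f = (p f)\<^sup>2))"

definition null_space :: "('a \<Rightarrow> real) set \<Rightarrow> (('a \<Rightarrow> real) \<Rightarrow> real) \<Rightarrow> ('a \<Rightarrow> real) set" where
  "null_space V J = {f \<in> V. J f = 0}"

definition orth_complement ::
  "('a \<Rightarrow> real) set \<Rightarrow> (('a \<Rightarrow> real) \<Rightarrow> ('a \<Rightarrow> real) \<Rightarrow> real)
    \<Rightarrow> ('a \<Rightarrow> real) set \<Rightarrow> ('a \<Rightarrow> real) set" where
  "orth_complement V ip W = {f \<in> V. \<forall>g\<in>W. ip f g = 0}"

text \<open>The basis is indexed by \<open>{1..N}\<close>; the value \<open>N = 0\<close> describes the zero space.\<close>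

definition orthonormal_basis ::
  "(('a \<Rightarrow> real) \<Rightarrow> ('a \<Rightarrow> real) \<Rightarrow> real) \<Rightarrow> ('a \<Rightarrow> real) set
    \<Rightarrow> nat \<Rightarrow> (nat \<Rightarrow> 'a \<Rightarrow> real) \<Rightarrow> bool" where
  "orthonormal_basis ip W N \<xi> \<longleftrightarrow>
     (\<forall>k\<in>{1..N}. \<forall>l\<in>{1..N}. ip (\<xi> k) (\<xi> l) = (if k = l then 1 else 0)) \<and>
     W = {f. \<exists>d :: nat \<Rightarrow> real. f = (\<lambda>t. \<Sum>k=1..N. d k * \<xi> k t)}"

definition kernel_operator ::
  "'a::euclidean_space set \<Rightarrow> ('a \<Rightarrow> 'a \<Rightarrow> real) \<Rightarrow> ('a \<Rightarrow> real) \<Rightarrow> 'a \<Rightarrow> real" where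
  "kernel_operator T K f t = (LINT s|lebesgue_on T. K t s * f s)"

definition linear_predictor ::
  "'a::euclidean_space set \<Rightarrow> real \<Rightarrow> ('a \<Rightarrow> real) \<Rightarrow> ('a \<Rightarrow> real) \<Rightarrow> real" where
  "linear_predictor T \<alpha> \<beta> X = \<alpha> + (LINT t|lebesgue_on T. X t * \<beta> t)"

definition depends_only_through ::
  "('b \<Rightarrow> real) set \<Rightarrow> 'b set \<Rightarrow> (('b \<Rightarrow> real) \<Rightarrow> real) \<Rightarrow> bool" where
  "depends_only_through E P L \<longleftrightarrow>
     (\<forall>\<eta>\<in>E. \<forall>\<eta>'\<in>E. (\<forall>X\<in>P. \<eta> X = \<eta>' X) \<longrightarrow> L \<eta> = L \<eta>')"

text \<open>
  \<open>L\<close> is the data-fit functional with the data already supplied.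
\<close>

definition is_reg_minimizer ::
  "'a::euclidean_space set \<Rightarrow> ('a \<Rightarrow> real) set \<Rightarrow> ((('a \<Rightarrow> real) \<Rightarrow> real) \<Rightarrow> real)
    \<Rightarrow> (('a \<Rightarrow> real) \<Rightarrow> real) \<Rightarrow> real \<Rightarrow> real \<Rightarrow> ('a \<Rightarrow> real) \<Rightarrow> bool" where
  "is_reg_minimizer T H L J lam \<alpha> \<beta> \<longleftrightarrow>
     is_arg_min (\<lambda>(a, b). L (linear_predictor T a b) + lam * J b) (\<lambda>(a, b). b \<in> H) (\<alpha>, \<beta>)"

end

theory Submission
  imports Defs
begin

text \<open>
  Split \<open>\<beta>hat = f0 + f1\<close> with \<open>f0\<close> in the null space and \<open>f1\<close> in its orthogonal complement
  \<open>V\<close>, and let \<open>m \<in> V\<close> have zero integral against every \<open>x i\<close>. Adding a multiple of \<open>m\<close> to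
  \<open>\<beta>hat\<close> does not change the data fit, so minimality (for \<open>lam > 0\<close>) forces \<open>f1\<close> to be
  orthogonal to \<open>m\<close>, while uniqueness (for \<open>lam = 0\<close>) forces \<open>m = 0\<close>. Thus
  the functional \<open>\<lambda>h. ip f1 h\<close> on \<open>V\<close> vanishes on the common kernel of the functionals
  \<open>\<lambda>h. \<integral> x i * h\<close>, hence is a linear combination of them; evaluating at the kernel sections
  \<open>\<lambda>s. K s t\<close> gives the representation of \<open>f1\<close>.
\<close>

section \<open>Linear dependence of functionals on a function space\<close>

definition linear_closed :: "('a \<Rightarrow> real) set \<Rightarrow> bool" where
  "linear_closed V \<longleftrightarrow> (\<forall>f\<in>V. \<forall>g\<in>V. \<forall>a b. (\<lambda>t. a * f t + b * g t) \<in> V)"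

text \<open>Linearity is confined to a carrier because \<open>ip\<close> is only specified on
  \<open>H\<close> and the integral is additive only on integrable functions.\<close>

definition linear_functional_on :: "('a \<Rightarrow> real) set \<Rightarrow> (('a \<Rightarrow> real) \<Rightarrow> real) \<Rightarrow> bool" where
  "linear_functional_on V \<phi> \<longleftrightarrow>
     (\<forall>f\<in>V. \<forall>g\<in>V. \<forall>a b. \<phi> (\<lambda>t. a * f t + b * g t) = a * \<phi> f + b * \<phi> g)"

lemma linear_closedD:
  "linear_closed V \<Longrightarrow> f \<in> V \<Longrightarrow> g \<in> V \<Longrightarrow> (\<lambda>t. a * f t + b * g t) \<in> V"
  by (simp add: linear_closed_def)

lemma linear_functional_onD:
  "linear_functional_on V \<phi> \<Longrightarrow> f \<in> V \<Longrightarrow> g \<in> V \<Longrightarrow>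
     \<phi> (\<lambda>t. a * f t + b * g t) = a * \<phi> f + b * \<phi> g"
  by (simp add: linear_functional_on_def)

lemma linear_functional_on_subset:
  "linear_functional_on V \<phi> \<Longrightarrow> W \<subseteq> V \<Longrightarrow> linear_functional_on W \<phi>"
  unfolding linear_functional_on_def by blast

text \<open>Induction on the number of functionals: on the kernel of \<open>\<phi> j\<close> the
  remaining functionals suffice, and what their combination misses on \<open>V\<close> vanishes on
  that kernel, so it is a multiple of \<open>\<phi> j\<close>. The space must vary in the induction,
  since the hypothesis is applied to the smaller kernel.\<close>

lemma linear_functional_combination:
  assumes "finite I" "linear_closed V" "linear_functional_on V \<psi>"
    and "\<And>i. i \<in> I \<Longrightarrow> linear_functional_on V (\<phi> i)"
    and "\<And>f. f \<in> V \<Longrightarrow> (\<And>i. i \<in> I \<Longrightarrow> \<phi> i f = 0) \<Longrightarrow> \<psi> f = 0"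
  shows "\<exists>c :: 'i \<Rightarrow> real. \<forall>f\<in>V. \<psi> f = (\<Sum>i\<in>I. c i * \<phi> i f)"
  using assms
proof (induction I arbitrary: V rule: finite_induct)
  case empty
  then show ?case by simp
next
  case (insert j I)
  note closed = linear_closedD[OF insert.prems(1)]
  note lin_\<psi> = linear_functional_onD[OF insert.prems(2)]
  note lin_\<phi> = linear_functional_onD[OF insert.prems(3)]
  \<comment> \<open>A zero of all \<open>\<phi> i\<close>, \<open>i \<in> I\<close>, lying in
    \<open>W\<close> is also a zero of \<open>\<phi> j\<close>, so the common-kernel hypothesis
    passes from \<open>insert j I\<close> on \<open>V\<close> to \<open>I\<close> on
    \<open>W\<close>.\<close>
  define W where "W = {f \<in> V. \<phi> j f = 0}"
  have "W \<subseteq> V" by (auto simp: W_def)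
  have "linear_closed W"
    unfolding linear_closed_def W_def
  proof (intro ballI allI CollectI conjI)
    fix f g a b
    assume "f \<in> {f \<in> V. \<phi> j f = 0}" "g \<in> {f \<in> V. \<phi> j f = 0}"
    then have fg: "f \<in> V" "g \<in> V" "\<phi> j f = 0" "\<phi> j g = 0" by auto
    show "(\<lambda>t. a * f t + b * g t) \<in> V" by (rule closed[OF fg(1,2)])
    show "\<phi> j (\<lambda>t. a * f t + b * g t) = 0"
      unfolding lin_\<phi>[OF insertI1 fg(1,2)] fg(3,4) by simp
  qed
  moreover have "linear_functional_on W \<psi>"
    by (rule linear_functional_on_subset[OF insert.prems(2) \<open>W \<subseteq> V\<close>])
  moreover have "linear_functional_on W (\<phi> i)" if "i \<in> I" for i
    by (rule linear_functional_on_subset[OF insert.prems(3)[OF insertI2[OF that]] \<open>W \<subseteq> V\<close>])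
  moreover have "\<psi> f = 0" if "f \<in> W" "\<And>i. i \<in> I \<Longrightarrow> \<phi> i f = 0" for f
    using that by (intro insert.prems(4)) (auto simp: W_def)
  ultimately have "\<exists>c. \<forall>f\<in>W. \<psi> f = (\<Sum>i\<in>I. c i * \<phi> i f)"
    by (rule insert.IH)
  then obtain c where c: "\<And>f. f \<in> W \<Longrightarrow> \<psi> f = (\<Sum>i\<in>I. c i * \<phi> i f)"
    by blast
  define r where "r e = \<psi> e - (\<Sum>i\<in>I. c i * \<phi> i e)" for e
  have lin_r: "r (\<lambda>t. a * f t + b * g t) = a * r f + b * r g" if "f \<in> V" "g \<in> V" for f g a b
  proof -
    have "(\<Sum>i\<in>I. c i * \<phi> i (\<lambda>t. a * f t + b * g t)) =
        (\<Sum>i\<in>I. a * (c i * \<phi> i f) + b * (c i * \<phi> i g))"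
    proof (rule sum.cong[OF refl])
      fix i assume "i \<in> I"
      show "c i * \<phi> i (\<lambda>t. a * f t + b * g t) = a * (c i * \<phi> i f) + b * (c i * \<phi> i g)"
        unfolding lin_\<phi>[OF insertI2[OF \<open>i \<in> I\<close>] that] by (simp add: algebra_simps)
    qed
    then show ?thesis
      unfolding r_def lin_\<psi>[OF that]
      by (simp add: sum.distrib sum_distrib_left right_diff_distrib)
  qed
  have "\<exists>u. \<forall>f\<in>V. r f = u * \<phi> j f"
  proof (cases "\<exists>e\<in>V. \<phi> j e \<noteq> 0")
    case True
    then obtain e where e: "e \<in> V" "\<phi> j e \<noteq> 0" by blast
    have "r f = r e / \<phi> j e * \<phi> j f" if "f \<in> V" for f
    proof -
      \<comment> \<open>The multiple of \<open>e\<close> is chosen to cancel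
        \<open>\<phi> j f\<close>. This puts \<open>?g\<close> in \<open>W\<close>, where the
        residual \<open>r\<close> is zero, and linearity of \<open>r\<close> then yields
        \<open>r f\<close>.\<close>
      let ?g = "\<lambda>t. 1 * f t + (- \<phi> j f / \<phi> j e) * e t"
      have "?g \<in> V" by (rule closed[OF that e(1)])
      moreover have "\<phi> j ?g = 0"
        unfolding lin_\<phi>[OF insertI1 that e(1)] using e(2) by simp
      ultimately have "?g \<in> W" by (simp only: W_def mem_Collect_eq)
      then have "r ?g = 0" by (simp only: r_def c)
      then show ?thesis unfolding lin_r[OF that e(1)] by simp
    qed
    then show ?thesis by blast
  next
    case False
    \<comment> \<open>Here \<open>\<phi> j\<close> vanishes on all of \<open>V\<close>, so
      \<open>W\<close> is \<open>V\<close> and \<open>r\<close> is already zero; any factor would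
      do.\<close>
    then have "r f = 0 * \<phi> j f" if "f \<in> V" for f
      using c[of f] that by (simp add: r_def W_def)
    then show ?thesis by blast
  qed
  then obtain u where u: "\<And>f. f \<in> V \<Longrightarrow> r f = u * \<phi> j f" by blast
  \<comment> \<open>Since \<open>j\<close> lies outside \<open>I\<close>, overwriting
    \<open>c\<close> at \<open>j\<close> leaves the sum over \<open>I\<close> unchanged.\<close>
  have "\<psi> f = (\<Sum>i\<in>insert j I. (c(j := u)) i * \<phi> i f)" if "f \<in> V" for f
  proof -
    have "(\<Sum>i\<in>I. (c(j := u)) i * \<phi> i f) = (\<Sum>i\<in>I. c i * \<phi> i f)"
      using insert.hyps by (intro sum.cong) auto
    then show ?thesis using u[OF that] insert.hyps by (simp add: r_def)
  qed
  then show ?case by blast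
qed

section \<open>Integral functionals on square integrable functions\<close>

lemma L2_on_mult_integrable:
  assumes "f \<in> L2_on T" "g \<in> L2_on T"
  shows "integrable (lebesgue_on T) (\<lambda>t. f t * g t)"
proof (rule Bochner_Integration.integrable_bound)
  show "integrable (lebesgue_on T) (\<lambda>t. (f t)\<^sup>2 + (g t)\<^sup>2)"
    using assms by (auto simp: L2_on_def)
  show "(\<lambda>t. f t * g t) \<in> borel_measurable (lebesgue_on T)"
    using assms by (auto simp: L2_on_def)
  have "\<bar>a * b\<bar> \<le> a\<^sup>2 + b\<^sup>2" for a b :: real
    using sum_squares_bound[of "\<bar>a\<bar>" "\<bar>b\<bar>"] abs_ge_zero[of "a * b"]
    unfolding power2_abs abs_mult by linarith
  then show "AE t in lebesgue_on T. norm (f t * g t) \<le> norm ((f t)\<^sup>2 + (g t)\<^sup>2)"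
    by simp
qed

lemma linear_functional_on_integral:
  assumes "V \<subseteq> L2_on T" "x \<in> L2_on T"
  shows "linear_functional_on V (\<lambda>f. LINT t|lebesgue_on T. x t * f t)"
  unfolding linear_functional_on_def
proof (intro ballI allI)
  fix f g a b assume "f \<in> V" "g \<in> V"
  then have "integrable (lebesgue_on T) (\<lambda>t. x t * f t)"
    "integrable (lebesgue_on T) (\<lambda>t. x t * g t)"
    using assms by (auto intro: L2_on_mult_integrable)
  moreover have "(\<lambda>t. x t * (a * f t + b * g t)) = (\<lambda>t. a * (x t * f t) + b * (x t * g t))"
    by (simp add: algebra_simps)
  ultimately show "(LINT t|lebesgue_on T. x t * (a * f t + b * g t)) =
      a * (LINT t|lebesgue_on T. x t * f t) + b * (LINT t|lebesgue_on T. x t * g t)"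
    by simp
qed

text \<open>The triangle inequality is used twice, for \<open>g + f\<close> and for
  \<open>f = (g + f) + (-1) * g\<close>; both times the null function contributes zero.\<close>

lemma squared_seminorm_add_null:
  assumes "squared_seminorm_on V J" "linear_closed V" "f \<in> V" "g \<in> V" "J g = 0"
  shows "J (\<lambda>t. g t + f t) = J f"
proof -
  from assms(1) obtain p where nonneg: "\<And>f. f \<in> V \<Longrightarrow> 0 \<le> p f"
    and scale: "\<And>a f. f \<in> V \<Longrightarrow> p (\<lambda>t. a * f t) = \<bar>a\<bar> * p f"
    and triangle: "\<And>f g. f \<in> V \<Longrightarrow> g \<in> V \<Longrightarrow> p (\<lambda>t. f t + g t) \<le> p f + p g"
    and J: "\<And>f. f \<in> V \<Longrightarrow> J f = (p f)\<^sup>2"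
    unfolding squared_seminorm_on_def seminorm_on_def by blast
  have "p g = 0" using J assms by simp
  have mem: "(\<lambda>t. g t + f t) \<in> V" "(\<lambda>t. - 1 * g t) \<in> V"
    using linear_closedD[OF assms(2,4,3), of 1 1] linear_closedD[OF assms(2,4,4), of "-1" 0]
    by simp_all
  have "p f \<le> p (\<lambda>t. g t + f t)"
    using triangle[OF mem] scale[OF assms(4), of "-1"] \<open>p g = 0\<close> by simp
  moreover have "p (\<lambda>t. g t + f t) \<le> p f"
    using triangle[OF assms(4,3)] \<open>p g = 0\<close> by simp
  ultimately show ?thesis using J mem(1) assms(3) by simp
qed

section \<open>Orthogonality, projection and kernel symmetry in the Hilbert space\<close>

context hilbert_function_space
begin

lemma linear_closed: "linear_closed H"
  unfolding linear_closed_def by (simp add: add_mem scale_mem)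

lemma ip_linear_left:
  assumes "f \<in> H" "g \<in> H" "h \<in> H"
  shows "ip (\<lambda>t. a * f t + b * g t) h = a * ip f h + b * ip g h"
  using assms by (simp add: ip_add_left ip_scale_left scale_mem)

lemma ip_linear_right:
  assumes "f \<in> H" "g \<in> H" "h \<in> H"
  shows "ip h (\<lambda>t. a * f t + b * g t) = a * ip h f + b * ip h g"
  using ip_linear_left[OF assms] assms linear_closedD[OF linear_closed assms(1,2)]
  by (metis ip_commute)

lemma ip_zero_left: "h \<in> H \<Longrightarrow> ip (\<lambda>t. 0) h = 0"
  using ip_scale_left[of h h 0] by simp

lemma sum_mem_and_ip:
  assumes "finite I" "\<And>k. k \<in> I \<Longrightarrow> \<xi> k \<in> H" "h \<in> H"
  shows "(\<lambda>t. \<Sum>k\<in>I. d k * \<xi> k t) \<in> H \<and>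
    ip (\<lambda>t. \<Sum>k\<in>I. d k * \<xi> k t) h = (\<Sum>k\<in>I. d k * ip (\<xi> k) h)"
  using assms
proof (induction I rule: finite_induct)
  case empty
  then show ?case by (simp add: zero_mem ip_zero_left)
next
  case (insert j I)
  then show ?case
    using add_mem[of "\<lambda>t. d j * \<xi> j t" "\<lambda>t. \<Sum>k\<in>I. d k * \<xi> k t"]
    by (simp add: ip_add_left ip_scale_left scale_mem)
qed

lemma orth_complement_linear_closed:
  assumes "W \<subseteq> H"
  shows "linear_closed (orth_complement H ip W)"
  unfolding linear_closed_def orth_complement_def
  using assms linear_closedD[OF linear_closed] by (auto simp: ip_linear_left subset_iff)

text \<open>The finite basis gives the projection explicitly: \<open>f0\<close> is the Fourier sum
  of \<open>f\<close>, and the remainder is orthogonal to each basis vector, hence to their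
  span.\<close>

lemma orthogonal_decomposition:
  assumes basis: "orthonormal_basis ip W N \<xi>" and "W \<subseteq> H" "f \<in> H"
  obtains f0 f1 where "f0 \<in> W" "f1 \<in> orth_complement H ip W" "f = (\<lambda>t. f0 t + f1 t)"
proof -
  have on: "ip (\<xi> k) (\<xi> l) = (if k = l then 1 else 0)" if "k \<in> {1..N}" "l \<in> {1..N}" for k l
    using basis that by (simp add: orthonormal_basis_def)
  have W: "W = {f. \<exists>d :: nat \<Rightarrow> real. f = (\<lambda>t. \<Sum>k=1..N. d k * \<xi> k t)}"
    using basis by (simp add: orthonormal_basis_def)
  have \<xi>: "\<xi> k \<in> H" if "k \<in> {1..N}" for k
  proof -
    \<comment> \<open>Kronecker delta coefficients exhibit each basis vector as a member of the span
      \<open>W\<close>, and so of \<open>H\<close>.\<close>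
    have "\<xi> k = (\<lambda>t. \<Sum>l=1..N. (if l = k then 1 else 0) * \<xi> l t)"
      using that by (simp add: if_distrib[of "\<lambda>c. c * _"] cong: if_cong)
    then have "\<xi> k \<in> W"
      unfolding W mem_Collect_eq by (rule exI[where x = "\<lambda>l. if l = k then 1 else 0"])
    then show ?thesis using \<open>W \<subseteq> H\<close> by blast
  qed
  note sum_ip = sum_mem_and_ip[of "{1..N}" \<xi>, OF finite_atLeastAtMost \<xi>]
  define f0 where "f0 = (\<lambda>t. \<Sum>k=1..N. ip f (\<xi> k) * \<xi> k t)"
  define f1 where "f1 = (\<lambda>t. 1 * f t + (- 1) * f0 t)"
  have "f0 \<in> W" unfolding W f0_def mem_Collect_eq
    by (rule exI[where x = "\<lambda>k. ip f (\<xi> k)"]) (rule refl)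
  then have "f0 \<in> H" using \<open>W \<subseteq> H\<close> by blast
  then have "f1 \<in> H" unfolding f1_def by (intro linear_closedD[OF linear_closed] \<open>f \<in> H\<close>)
  have ortho: "ip (\<xi> l) f1 = 0" if "l \<in> {1..N}" for l
  proof -
    have "ip f0 (\<xi> l) = (\<Sum>k=1..N. ip f (\<xi> k) * ip (\<xi> k) (\<xi> l))"
      unfolding f0_def using sum_ip[OF _ \<xi>[OF that], of "\<lambda>k. ip f (\<xi> k)"] by simp
    also have "\<dots> = (\<Sum>k=1..N. if k = l then ip f (\<xi> k) else 0)"
      by (intro sum.cong refl) (simp add: on[OF _ that])
    finally have "ip f0 (\<xi> l) = ip f (\<xi> l)"
      using that by simp
    then have "ip f1 (\<xi> l) = 0"
      unfolding f1_def using ip_linear_left[OF \<open>f \<in> H\<close> \<open>f0 \<in> H\<close> \<xi>[OF that], of 1 "-1"] by simp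
    then show ?thesis using ip_commute[OF \<open>f1 \<in> H\<close> \<xi>[OF that]] by simp
  qed
  have "ip f1 g = 0" if "g \<in> W" for g
  proof -
    from that[unfolded W mem_Collect_eq]
    obtain d :: "nat \<Rightarrow> real" where g: "g = (\<lambda>t. \<Sum>k=1..N. d k * \<xi> k t)"
      by (rule exE)
    have "ip g f1 = 0"
      unfolding g using sum_ip[OF _ \<open>f1 \<in> H\<close>, of d] ortho by simp
    then show ?thesis
      using ip_commute[OF \<open>f1 \<in> H\<close>, of g] that \<open>W \<subseteq> H\<close> by auto
  qed
  then have "f1 \<in> orth_complement H ip W"
    using \<open>f1 \<in> H\<close> by (simp add: orth_complement_def)
  moreover have "f = (\<lambda>t. f0 t + f1 t)" by (simp add: f1_def)
  ultimately show ?thesis using that \<open>f0 \<in> W\<close> by blast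
qed

text \<open>First-order condition: the squared norm along the line \<open>f + s * m\<close> is a
  quadratic in \<open>s\<close> minimal at \<open>s = 0\<close>, so its linear coefficient
  \<open>2 * ip f m\<close> must vanish.\<close>

lemma ip_eq_zero_if_norm_minimal:
  assumes "f \<in> H" "m \<in> H"
    and le: "\<And>s. ip f f \<le> ip (\<lambda>t. f t + s * m t) (\<lambda>t. f t + s * m t)"
  shows "ip f m = 0"
proof (rule ccontr)
  define p q where "p = ip f m" and "q = ip m m"
  assume "ip f m \<noteq> 0"
  then have "0 < p\<^sup>2" by (simp add: p_def)
  have "0 \<le> q" unfolding q_def by (rule ip_nonneg) fact
  have quad: "0 \<le> 2 * s * p + s\<^sup>2 * q" for s
  proof -
    have "(\<lambda>t. f t + s * m t) \<in> H"
      using assms(1,2) by (intro add_mem scale_mem)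
    then have "ip (\<lambda>t. f t + s * m t) (\<lambda>t. f t + s * m t) = ip f f + 2 * s * p + s\<^sup>2 * q"
      using ip_linear_left[OF assms(1,2), of "\<lambda>t. f t + s * m t" 1 s]
        ip_linear_right[OF assms(1,2,1), of 1 s] ip_linear_right[OF assms(1,2,2), of 1 s]
        ip_commute[OF assms(1,2)]
      by (simp add: p_def q_def algebra_simps power2_eq_square)
    then show ?thesis using le[of s] by simp
  qed
  \<comment> \<open>The vertex of the quadratic would be at \<open>- p / q\<close>; the denominator
    \<open>q + 1\<close> also covers \<open>q = 0\<close> and still gives a strictly negative
    value.\<close>
  have "2 * (- p / (q + 1)) * p + (- p / (q + 1))\<^sup>2 * q = - (p\<^sup>2 * (q + 2) / (q + 1)\<^sup>2)"
    using \<open>0 \<le> q\<close> by (simp add: divide_simps power2_eq_square) algebra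
  moreover have "0 < p\<^sup>2 * (q + 2) / (q + 1)\<^sup>2"
    using \<open>0 < p\<^sup>2\<close> \<open>0 \<le> q\<close> by simp
  ultimately show False using quad[of "- p / (q + 1)"] by linarith
qed

text \<open>Both values are inner products of the sections at \<open>s\<close> and \<open>t\<close>,
  in opposite orders. This reconciles \<open>reproducing_kernel\<close>, which uses sections in the
  first argument, with \<open>kernel_operator\<close>, which integrates over the second.\<close>

lemma reproducing_kernel_symmetric:
  assumes "reproducing_kernel T V ip K" "V \<subseteq> H" "s \<in> T" "t \<in> T"
  shows "K s t = K t s"
proof -
  have mem: "(\<lambda>u. K u s) \<in> V" "(\<lambda>u. K u t) \<in> V"
    and repr: "\<And>f. f \<in> V \<Longrightarrow> f s = ip f (\<lambda>u. K u s)" "\<And>f. f \<in> V \<Longrightarrow> f t = ip f (\<lambda>u. K u t)"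
    using assms(1,3,4) by (auto simp: reproducing_kernel_def)
  show ?thesis
    using repr(1)[OF mem(2)] repr(2)[OF mem(1)] ip_commute mem \<open>V \<subseteq> H\<close> by (metis subsetD)
qed

end

section \<open>Finite-dimensional form of the regularized slope estimator\<close>

theorem theorem1:
  fixes T :: "'a::euclidean_space set"
    and H :: "('a \<Rightarrow> real) set"
    and ip :: "('a \<Rightarrow> real) \<Rightarrow> ('a \<Rightarrow> real) \<Rightarrow> real"
    and J :: "('a \<Rightarrow> real) \<Rightarrow> real"
    and K :: "'a \<Rightarrow> 'a \<Rightarrow> real"
    and N n :: nat
    and \<xi> x :: "nat \<Rightarrow> 'a \<Rightarrow> real"
    and y :: "nat \<Rightarrow> real"
    and ell :: "(('a \<Rightarrow> real) \<times> real) list \<Rightarrow> (('a \<Rightarrow> real) \<Rightarrow> real) \<Rightarrow> real"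
    and lam \<alpha>hat :: real
    and \<beta>hat :: "'a \<Rightarrow> real"
  assumes "compact T"
    and "rkhs T H ip"
    and "H \<subseteq> L2_on T"
    and "squared_seminorm_on H J"
    and "orthonormal_basis ip (null_space H J) N \<xi>"
    and "reproducing_kernel T (orth_complement H ip (null_space H J)) ip K"
    and "\<And>f. f \<in> orth_complement H ip (null_space H J) \<Longrightarrow> J f = ip f f"
    and "continuous_on (T \<times> T) (\<lambda>(s, t). K s t)"
    and "integrable (lebesgue_on (T \<times> T)) (\<lambda>(s, t). (K s t)\<^sup>2)"
    and "\<And>i. i \<in> {1..n} \<Longrightarrow> x i \<in> L2_on T"
    and "depends_only_through {linear_predictor T \<alpha> \<beta> | \<alpha> \<beta>. \<beta> \<in> H} (x ` {1..n})
           (ell (map (\<lambda>i. (x i, y i)) [1..<Suc n]))"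
    and "0 \<le> lam"
    and "is_reg_minimizer T H (ell (map (\<lambda>i. (x i, y i)) [1..<Suc n])) J lam \<alpha>hat \<beta>hat"
    and "\<And>\<alpha> \<beta>. lam = 0 \<Longrightarrow>
           is_reg_minimizer T H (ell (map (\<lambda>i. (x i, y i)) [1..<Suc n])) J lam \<alpha> \<beta> \<Longrightarrow>
           \<beta> = \<beta>hat"
  shows "\<exists>(d :: nat \<Rightarrow> real) (c :: nat \<Rightarrow> real). \<forall>t\<in>T.
           \<beta>hat t = (\<Sum>k=1..N. d k * \<xi> k t) + (\<Sum>i=1..n. c i * kernel_operator T K (x i) t)"
proof -
  interpret rkhs T H ip by fact
  let ?W = "null_space H J"
  let ?V = "orth_complement H ip ?W"
  let ?L = "ell (map (\<lambda>i. (x i, y i)) [1..<Suc n])"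
  define \<phi> where "\<phi> i f = (LINT t|lebesgue_on T. x i t * f t)" for i f
  have "?W \<subseteq> H" by (auto simp: null_space_def)
  have "?V \<subseteq> H" by (auto simp: orth_complement_def)
  have V_closed: "linear_closed ?V"
    by (rule orth_complement_linear_closed) fact
  have "\<beta>hat \<in> H"
    using assms(13) by (simp add: is_reg_minimizer_def is_arg_min_def)
  have minimal: "?L (linear_predictor T \<alpha>hat \<beta>hat) + lam * J \<beta>hat
      \<le> ?L (linear_predictor T a b) + lam * J b" if "b \<in> H" for a b
    using assms(13) that by (auto simp: is_reg_minimizer_def is_arg_min_def not_less)
  have \<phi>_linear: "linear_functional_on H (\<phi> i)" if "i \<in> {1..n}" for i
    unfolding \<phi>_def using linear_functional_on_integral[OF assms(3) assms(10)[OF that]] .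
  obtain f0 f1 where f: "f0 \<in> ?W" "f1 \<in> ?V" "\<beta>hat = (\<lambda>t. f0 t + f1 t)"
    using orthogonal_decomposition[OF assms(5) \<open>?W \<subseteq> H\<close> \<open>\<beta>hat \<in> H\<close>] .
  have f0: "f0 \<in> H" "J f0 = 0" using f(1) by (auto simp: null_space_def)
  \<comment> \<open>The null-space part leaves the penalty unchanged, and on the complement the
    penalty is the squared norm.\<close>
  have J_split: "J (\<lambda>t. f0 t + g t) = ip g g" if "g \<in> ?V" for g
    using squared_seminorm_add_null[of H J g f0] assms(4) linear_closed that \<open>?V \<subseteq> H\<close>
      f0 assms(7)[OF that] by (metis subsetD)
  \<comment> \<open>With the intercept fixed, a perturbation annihilated by every
    \<open>\<phi> i\<close> gives the same prediction at each \<open>x i\<close>, and the data fit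
    sees nothing else.\<close>
  have same_fit: "?L (linear_predictor T \<alpha>hat (\<lambda>t. \<beta>hat t + s * m t)) =
      ?L (linear_predictor T \<alpha>hat \<beta>hat)"
    if "m \<in> ?V" "\<And>i. i \<in> {1..n} \<Longrightarrow> \<phi> i m = 0" for m s
  proof -
    have "m \<in> H" using that \<open>?V \<subseteq> H\<close> by blast
    have "linear_predictor T \<alpha>hat (\<lambda>t. \<beta>hat t + s * m t) (x i) =
        linear_predictor T \<alpha>hat \<beta>hat (x i)" if "i \<in> {1..n}" for i
      using linear_functional_onD[OF \<phi>_linear[OF that] \<open>\<beta>hat \<in> H\<close> \<open>m \<in> H\<close>, of 1 s]
        \<open>\<And>i. i \<in> {1..n} \<Longrightarrow> \<phi> i m = 0\<close>[OF that]
      by (simp add: linear_predictor_def \<phi>_def)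
    moreover have "(\<lambda>t. \<beta>hat t + s * m t) \<in> H"
      using \<open>\<beta>hat \<in> H\<close> \<open>m \<in> H\<close> by (intro add_mem scale_mem)
    ultimately show ?thesis
      using assms(11) \<open>\<beta>hat \<in> H\<close> unfolding depends_only_through_def by blast
  qed
  have orthogonal: "ip f1 m = 0"
    if m: "m \<in> ?V" "\<And>i. i \<in> {1..n} \<Longrightarrow> \<phi> i m = 0" for m
  proof (cases "lam = 0")
    case True
    have "m \<in> H" "f1 \<in> H" using m(1) f(2) \<open>?V \<subseteq> H\<close> by auto
    have "(\<lambda>t. \<beta>hat t + 1 * m t) \<in> H"
      using \<open>\<beta>hat \<in> H\<close> \<open>m \<in> H\<close> by (intro add_mem scale_mem)
    \<comment> \<open>For \<open>lam = 0\<close> the objective is the data fit alone, so the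
      perturbed slope is again a minimizer; uniqueness then forces \<open>m\<close> to be
      zero.\<close>
    then have "is_reg_minimizer T H ?L J lam \<alpha>hat (\<lambda>t. \<beta>hat t + 1 * m t)"
      using minimal same_fit[OF m, where s = 1] True
      by (auto simp: is_reg_minimizer_def is_arg_min_def not_less)
    then have "(\<lambda>t. \<beta>hat t + 1 * m t) = \<beta>hat"
      using assms(14) True by blast
    then have "m = (\<lambda>t. 0)" by (simp add: fun_eq_iff)
    then show ?thesis
      using ip_zero_left[OF \<open>f1 \<in> H\<close>] ip_commute[OF \<open>f1 \<in> H\<close> zero_mem] by simp
  next
    case False
    with assms(12) have "0 < lam" by simp
    have "m \<in> H" "f1 \<in> H" using m(1) f(2) \<open>?V \<subseteq> H\<close> by auto
    then show ?thesis
    proof (intro ip_eq_zero_if_norm_minimal)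
      fix s
      have "(\<lambda>t. \<beta>hat t + s * m t) \<in> H"
        using \<open>\<beta>hat \<in> H\<close> \<open>m \<in> H\<close> by (intro add_mem scale_mem)
      \<comment> \<open>The equal data fits cancel, and dividing by \<open>lam > 0\<close> leaves a
        comparison of penalties, which \<open>J_split\<close> turns into one of squared
        norms.\<close>
      then have "J \<beta>hat \<le> J (\<lambda>t. \<beta>hat t + s * m t)"
        using minimal[of "\<lambda>t. \<beta>hat t + s * m t" \<alpha>hat] same_fit[OF m, where s = s] \<open>0 < lam\<close>
        by simp
      moreover have "(\<lambda>t. f1 t + s * m t) \<in> ?V"
        using linear_closedD[OF V_closed f(2) m(1), of 1 s] by simp
      ultimately show "ip f1 f1 \<le> ip (\<lambda>t. f1 t + s * m t) (\<lambda>t. f1 t + s * m t)"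
        using J_split[OF f(2)] J_split[of "\<lambda>t. f1 t + s * m t"] by (simp add: f(3) add.assoc)
    qed
  qed
  have "linear_functional_on ?V (ip f1)"
    unfolding linear_functional_on_def using f(2) \<open>?V \<subseteq> H\<close>
    by (auto simp: ip_linear_right subset_iff)
  \<comment> \<open>By \<open>orthogonal\<close>, the functional \<open>ip f1\<close> vanishes on
    the common kernel of the \<open>\<phi> i\<close> in the complement, so it is a combination of
    them; its coefficients are the required \<open>c\<close>.\<close>
  then obtain c :: "nat \<Rightarrow> real" where c: "\<And>h. h \<in> ?V \<Longrightarrow> ip f1 h = (\<Sum>i=1..n. c i * \<phi> i h)"
    using linear_functional_combination[of "{1..n}" ?V "ip f1" \<phi>] V_closed orthogonal
      linear_functional_on_subset[OF \<phi>_linear \<open>?V \<subseteq> H\<close>] by auto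
  have "f1 t = (\<Sum>i=1..n. c i * kernel_operator T K (x i) t)" if "t \<in> T" for t
  proof -
    have K: "(\<lambda>s. K s t) \<in> ?V" "f1 t = ip f1 (\<lambda>s. K s t)"
      using assms(6) that f(2) by (auto simp: reproducing_kernel_def)
    \<comment> \<open>Testing at the kernel section recovers \<open>f1 t\<close> on one side and,
      after swapping the kernel arguments, \<open>K\<close> applied to \<open>x i\<close> on the
      other. Symmetry is available only for points of \<open>T\<close>, which is the whole space of
      \<open>lebesgue_on T\<close>.\<close>
    have "\<phi> i (\<lambda>s. K s t) = kernel_operator T K (x i) t" for i
      unfolding \<phi>_def kernel_operator_def
      using reproducing_kernel_symmetric[OF assms(6) \<open>?V \<subseteq> H\<close> _ that]
      by (intro Bochner_Integration.integral_cong) (auto simp: space_restrict_space)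
    then show ?thesis using K c by simp
  qed
  moreover have "\<exists>d :: nat \<Rightarrow> real. f0 = (\<lambda>t. \<Sum>k=1..N. d k * \<xi> k t)"
  proof -
    have "?W = {f. \<exists>d :: nat \<Rightarrow> real. f = (\<lambda>t. \<Sum>k=1..N. d k * \<xi> k t)}"
      using assms(5) by (simp only: orthonormal_basis_def)
    then have "f0 \<in> {f. \<exists>d :: nat \<Rightarrow> real. f = (\<lambda>t. \<Sum>k=1..N. d k * \<xi> k t)}"
      using f(1) by (rule subst)
    then show ?thesis by (rule CollectD)
  qed
  then obtain d :: "nat \<Rightarrow> real" where "f0 = (\<lambda>t. \<Sum>k=1..N. d k * \<xi> k t)"
    by (rule exE)
  ultimately show ?thesis using f(3) by auto
qed

end
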